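(* Let $\mathfrak g$ be a simple complete left-symmetric algebra over $\mathbb C$ whose canonical decomposition $\mathfrak g=\bigoplus_\lambda\mathfrak g^\lambda$ satisfies $\dim\mathfrak g^\lambda\le 1$ for all $\lambda$. Then for any $\lambda\in\Lambda$ the graph $\Gamma_l$ contains an edge parallel to $\overline{0\lambda}$ (i.e. an edge from $\mu$ to $\mu+\lambda$ for some $\mu\in\Lambda$ with $\mu+\lambda\in\Lambda$), and the graph $\Gamma_r$ has an edge that comes out of $\lambda$.
   Context: All algebras are finite dimensional. A left-symmetric algebra is a vector space $\mathfrak g$ with a bilinear product such that $x(yz)-(xy)z=y(xz)-(yx)z$ for all $x,y,z$. Then $[x,y]=xy-yx$ is a Lie bracket and $L(x)y=xy$ defines a representation of the Lie algebra $\mathfrak g$. The fields $F_x(y)=xy+x$, $x\in\mathfrak g$, form a Lie algebra of affine vector fields on the space $\mathfrak g$; $\mathfrak g$ is complete if the group of affine transformations generated by their flows acts transitively on $\mathfrak g$. A subspace $\mathfrak j\subseteq\mathfrak g$ is an ideal if $\mathfrak j\mathfrak g\subseteq\mathfrak j$ and $\mathfrak g\mathfrak j\subseteq\mathfrak j$ (a two-sided ideal); $\mathfrak g$ is simple if it contains no proper ideals. Canonical decomposition: a complete left-symmetric algebra over $\mathbb C$ has a unique Cartan subalgebra $\mathfrak h$ of the Lie algebra $\mathfrak g$ such that, for every linear functional $\lambda$ on $\mathfrak h$, the root subspace (generalized weight space) $\mathfrak g^\lambda$ of $\lambda$ for $L|_{\mathfrak h}$ equals the root subspace for $\operatorname{ad}|_{\mathfrak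 h}$, where $\operatorname{ad}(x)y=[x,y]$; the canonical decomposition is $\mathfrak g=\bigoplus_\lambda\mathfrak g^\lambda$, and $\mathfrak g^0=\mathfrak h$. It satisfies $\mathfrak g^\lambda\mathfrak g^\mu\subseteq\mathfrak g^{\lambda+\mu}$. Graphs: assume $\dim\mathfrak g^\lambda\le1$ for all $\lambda$. Fix $e_0\in\mathfrak g^0$, $e_0\neq0$. Identify each functional $\lambda$ with $\mathfrak g^\lambda\ne0$ with the number $\lambda(e_0)$; the set of these numbers is $\Lambda\subset\mathbb C$, the spectrum of $L(e_0)$ (it contains $0$). For each $\lambda\in\Lambda$ choose an eigenvector $e_\lambda\in\mathfrak g^\lambda$, $e_0e_\lambda=\lambda e_\lambda$ (with the chosen $e_0$ for $\lambda=0$). In the base $\{e_\lambda\}_{\lambda\in\Lambda}$ the product is $e_\lambda e_\mu=c_{\lambda,\mu}e_{\lambda+\mu}$, with the convention $e_\lambda=0$ and $c_{\lambda,\mu}=c_{\mu,\lambda}=0$ if $\lambda\notin\Lambda$. $\Gamma_l$ and $\Gamma_r$ are the directed graphs (loops allowed) with vertex set $\Lambda$: $\Gamma_l$ has an edge from $\lambda$ to $\mu$ if and only if $c_{\mu-\lambda,\lambda}\neq0$; $\Gamma_r$ has an edge from $\lambda$ to $\mu$ if and only if $c_{\lambda,\mu-\lambda}\neq0$.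
   Formalization: "Simple" is taken to include that the product is not identically zero; this excludes only the one-dimensional algebra with zero product, which has no proper ideals and is complete, but whose graphs have no edges, so the claim fails for it. *)

theory Defs
  imports Complex_Main "HOL-Algebra.Bij" "HOL-Algebra.Generated_Groups"
begin

locale left_symmetric_algebra =
  vector_space scale
  for scale :: "complex \<Rightarrow> 'a::ab_group_add \<Rightarrow> 'a" (infixr \<open>*\<^sub>C\<close> 75) +
  fixes mult :: "'a \<Rightarrow> 'a \<Rightarrow> 'a" (infixl \<open>\<bullet>\<close> 70)
  assumes finite_dim: "\<exists>B. finite B \<and> span B = UNIV"
    and mult_add_left: "(x + y) \<bullet> z = x \<bullet> z + y \<bullet> z"
    and mult_add_right: "x \<bullet> (y + z) = x \<bullet> y + x \<bullet> z"
    and mult_scale_left: "(a *\<^sub>C x) \<bullet> y = a *\<^sub>C (x \<bullet> y)"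
    and mult_scale_right: "x \<bullet> (a *\<^sub>C y) = a *\<^sub>C (x \<bullet> y)"
    and left_symmetric: "x \<bullet> (y \<bullet> z) - (x \<bullet> y) \<bullet> z = y \<bullet> (x \<bullet> z) - (y \<bullet> x) \<bullet> z"
begin

definition bracket :: "'a \<Rightarrow> 'a \<Rightarrow> 'a" where
  "bracket x y = x \<bullet> y - y \<bullet> x"

definition two_sided_ideal :: "'a set \<Rightarrow> bool" where
  "two_sided_ideal J \<longleftrightarrow> subspace J \<and> (\<forall>x\<in>J. \<forall>y. x \<bullet> y \<in> J \<and> y \<bullet> x \<in> J)"

text \<open>As usual for nonassociative algebras, a simple algebra is required to have a nonzero
  product. This excludes the one-dimensional algebra with zero product, which is complete
  and has no ideals except zero and itself.\<close>

definition simple :: bool where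
  "simple \<longleftrightarrow> (\<exists>x y. x \<bullet> y \<noteq> 0) \<and> (\<forall>J. two_sided_ideal J \<longrightarrow> J = {0} \<or> J = UNIV)"

definition affine_field :: "'a \<Rightarrow> 'a \<Rightarrow> 'a" where
  "affine_field x y = x \<bullet> y + x"

text \<open>The underlying space carries no topology here. Differentiability of a curve in a
  finite-dimensional space is differentiability of its image under all linear functionals.\<close>

definition integral_curve :: "'a \<Rightarrow> (real \<Rightarrow> 'a) \<Rightarrow> bool" where
  "integral_curve x \<gamma> \<longleftrightarrow>
     (\<forall>\<phi>. Vector_Spaces.linear scale (*) \<phi> \<longrightarrow>
        (\<forall>t. ((\<lambda>s. \<phi> (\<gamma> s)) has_vector_derivative \<phi> (affine_field x (\<gamma> t))) (at t)))"

definition is_flow :: "'a \<Rightarrow> (real \<Rightarrow> 'a \<Rightarrow> 'a) \<Rightarrow> bool" where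
  "is_flow x \<Phi> \<longleftrightarrow> (\<forall>y. \<Phi> 0 y = y \<and> integral_curve x (\<lambda>t. \<Phi> t y))"

text \<open>Real time suffices: the affine fields depend linearly on \<open>x\<close>, so the flow of \<open>x\<close> at
  complex time \<open>c\<close> is the flow of \<open>c *\<^sub>C x\<close> at time 1.\<close>

definition flow_group :: "('a \<Rightarrow> 'a) set" where
  "flow_group = generate (BijGroup UNIV) {\<Phi> t |x \<Phi> t. is_flow x \<Phi>}"

definition complete :: bool where
  "complete \<longleftrightarrow> (\<forall>y z. \<exists>f\<in>flow_group. f y = z)"

definition lie_subalgebra :: "'a set \<Rightarrow> bool" where
  "lie_subalgebra h \<longleftrightarrow> subspace h \<and> (\<forall>x\<in>h. \<forall>y\<in>h. bracket x y \<in> h)"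

fun lower_central :: "'a set \<Rightarrow> nat \<Rightarrow> 'a set" where
  "lower_central h 0 = h"
| "lower_central h (Suc n) = span {bracket x y |x y. x \<in> h \<and> y \<in> lower_central h n}"

definition cartan_subalgebra :: "'a set \<Rightarrow> bool" where
  "cartan_subalgebra h \<longleftrightarrow>
     lie_subalgebra h \<and> (\<exists>n. lower_central h n = {0}) \<and>
     {x. \<forall>y\<in>h. bracket x y \<in> h} = h"

definition functional_on :: "'a set \<Rightarrow> ('a \<Rightarrow> complex) \<Rightarrow> bool" where
  "functional_on h l \<longleftrightarrow>
     (\<forall>x\<in>h. \<forall>y\<in>h. l (x + y) = l x + l y) \<and> (\<forall>a. \<forall>x\<in>h. l (a *\<^sub>C x) = a * l x)"

definition root_space :: "('a \<Rightarrow> 'a \<Rightarrow> 'a) \<Rightarrow> 'a set \<Rightarrow> ('a \<Rightarrow> complex) \<Rightarrow> 'a set" where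
  "root_space \<rho> h l = {v. \<forall>x\<in>h. \<exists>n. ((\<lambda>w. \<rho> x w - l x *\<^sub>C w) ^^ n) v = 0}"

text \<open>The representations \<open>L\<close> and \<open>ad\<close> are the curried operations \<open>mult\<close> and \<open>bracket\<close>.\<close>

definition canonical_cartan :: "'a set \<Rightarrow> bool" where
  "canonical_cartan h \<longleftrightarrow>
     cartan_subalgebra h \<and>
     (\<forall>l. functional_on h l \<longrightarrow> root_space mult h l = root_space bracket h l)"

definition root_numbers :: "'a set \<Rightarrow> 'a \<Rightarrow> complex set" where
  "root_numbers h e0 = {l e0 |l. functional_on h l \<and> root_space mult h l \<noteq> {0}}"

definition root_base :: "'a set \<Rightarrow> 'a \<Rightarrow> (complex \<Rightarrow> 'a) \<Rightarrow> bool" where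
  "root_base h e0 e \<longleftrightarrow>
     e 0 = e0 \<and>
     (\<forall>l. functional_on h l \<and> root_space mult h l \<noteq> {0} \<longrightarrow>
        e (l e0) \<in> root_space mult h l \<and> e (l e0) \<noteq> 0 \<and> e0 \<bullet> e (l e0) = l e0 *\<^sub>C e (l e0)) \<and>
     (\<forall>z. z \<notin> root_numbers h e0 \<longrightarrow> e z = 0)"

text \<open>If \<open>\<alpha>\<close> and \<open>\<beta>\<close> are in \<open>\<Lambda>\<close> but \<open>\<alpha> + \<beta>\<close> is not, then \<open>e (\<alpha> + \<beta>) = 0\<close> and \<open>c \<alpha> \<beta>\<close> is
  arbitrary. The graphs below do not use these values, since both ends of an edge lie in \<open>\<Lambda>\<close>.\<close>

definition structure_constants ::
    "complex set \<Rightarrow> (complex \<Rightarrow> 'a) \<Rightarrow> (complex \<Rightarrow> complex \<Rightarrow> complex) \<Rightarrow> bool" where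
  "structure_constants \<Lambda> e c \<longleftrightarrow>
     (\<forall>\<alpha>\<in>\<Lambda>. \<forall>\<beta>\<in>\<Lambda>. e \<alpha> \<bullet> e \<beta> = c \<alpha> \<beta> *\<^sub>C e (\<alpha> + \<beta>)) \<and>
     (\<forall>\<alpha> \<beta>. \<alpha> \<notin> \<Lambda> \<longrightarrow> c \<alpha> \<beta> = 0 \<and> c \<beta> \<alpha> = 0)"

end

definition Gamma_l :: "complex set \<Rightarrow> (complex \<Rightarrow> complex \<Rightarrow> complex) \<Rightarrow> (complex \<times> complex) set" where
  "Gamma_l \<Lambda> c = {(\<alpha>, \<beta>). \<alpha> \<in> \<Lambda> \<and> \<beta> \<in> \<Lambda> \<and> c (\<beta> - \<alpha>) \<alpha> \<noteq> 0}"

definition Gamma_r :: "complex set \<Rightarrow> (complex \<Rightarrow> complex \<Rightarrow> complex) \<Rightarrow> (complex \<times> complex) set" where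
  "Gamma_r \<Lambda> c = {(\<alpha>, \<beta>). \<alpha> \<in> \<Lambda> \<and> \<beta> \<in> \<Lambda> \<and> c \<alpha> (\<beta> - \<alpha>) \<noteq> 0}"

end

theory Submission
  imports Defs "HOL-Computational_Algebra.Fundamental_Theorem_Algebra"
begin

text \<open>
  Both conclusions say the same thing: an edge of the left graph parallel to \<open>\<alpha>\<close>, and an edge of
  the right graph coming out of \<open>\<alpha>\<close>, each mean that \<open>e \<alpha> \<bullet> e \<beta> \<noteq> 0\<close> for some \<open>\<beta> \<in> \<Lambda>\<close>. Since the
  vectors \<open>e \<beta>\<close> span the algebra, this holds if and only if left multiplication by \<open>e \<alpha>\<close> is not
  the zero operator.

  Now \<open>L\<close> is a representation of the commutator Lie algebra, so its kernel \<open>K\<close> is a Lie ideal.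
  Elements of \<open>K\<close> annihilate everything from the left, so \<open>y \<bullet> x = bracket y x\<close> for \<open>x \<in> K\<close>, and a
  Lie ideal inside the kernel is automatically two-sided (\<open>two_sided_ideal_left_kernel\<close>). In a
  simple algebra the kernel is therefore zero (\<open>simple_left_faithful\<close>).

  It remains to see that the root vectors span. As \<open>h\<close> is nilpotent it lies in its own zero root
  space for the adjoint action, hence in the one for \<open>L\<close>, which is the line through \<open>e0\<close>;
  being its own normalizer in a nonzero algebra, \<open>h\<close> is not zero, so it is that line
  (\<open>canonical_cartan_line\<close>). The root spaces are then the generalized eigenspaces of the
  single operator \<open>L e0\<close>, and these span a finite-dimensional complex space
  (\<open>span_gen_eigenspaces\<close>).
\<close>

section \<open>Generalized eigenspaces of an endomorphism\<close>

locale endomorphism = vector_space scale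
  for scale :: "complex \<Rightarrow> 'a::ab_group_add \<Rightarrow> 'a" (infixr \<open>*\<^sub>C\<close> 75) +
  fixes T :: "'a \<Rightarrow> 'a"
  assumes T_add: "T (x + y) = T x + T y"
    and T_scale: "T (a *\<^sub>C x) = a *\<^sub>C T x"
begin

definition shift :: "complex \<Rightarrow> 'a \<Rightarrow> 'a" where
  "shift a v = T v - a *\<^sub>C v"

definition gen_eigenspace :: "complex \<Rightarrow> 'a set" where
  "gen_eigenspace a = {v. \<exists>n. (shift a ^^ n) v = 0}"

definition poly_apply :: "complex poly \<Rightarrow> 'a \<Rightarrow> 'a" where
  "poly_apply p v = (\<Sum>i\<le>degree p. coeff p i *\<^sub>C (T ^^ i) v)"

lemma shift_add: "shift a (x + y) = shift a x + shift a y"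
  by (simp add: shift_def T_add scale_right_distrib)

lemma shift_scale: "shift a (b *\<^sub>C x) = b *\<^sub>C shift a x"
  by (simp add: shift_def T_scale scale_right_diff_distrib scale_left_commute)

lemma shift_diff: "shift a (x - y) = shift a x - shift a y"
  using shift_add[of a "x - y" y] by simp

lemma funpow_shift_add: "(shift a ^^ n) (x + y) = (shift a ^^ n) x + (shift a ^^ n) y"
  by (induction n) (auto simp: shift_add)

lemma funpow_shift_scale: "(shift a ^^ n) (b *\<^sub>C x) = b *\<^sub>C (shift a ^^ n) x"
  by (induction n) (auto simp: shift_scale)

lemma funpow_shift_zero: "(shift a ^^ n) 0 = 0"
  using funpow_shift_scale[of n a 0 0] by simp

lemma subspace_gen_eigenspace: "subspace (gen_eigenspace a)"
proof (rule subspaceI)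
  show "0 \<in> gen_eigenspace a"
    by (auto simp: gen_eigenspace_def funpow_shift_zero)
next
  fix x y assume "x \<in> gen_eigenspace a" "y \<in> gen_eigenspace a"
  then obtain m n where mn: "(shift a ^^ m) x = 0" "(shift a ^^ n) y = 0"
    by (auto simp: gen_eigenspace_def)
  have "(shift a ^^ (n + m)) x = 0" "(shift a ^^ (m + n)) y = 0"
    unfolding funpow_add by (simp_all add: mn funpow_shift_zero)
  then have "(shift a ^^ (m + n)) (x + y) = 0"
    by (simp add: funpow_shift_add add.commute)
  then show "x + y \<in> gen_eigenspace a"
    by (auto simp: gen_eigenspace_def)
next
  fix b x assume "x \<in> gen_eigenspace a"
  then show "b *\<^sub>C x \<in> gen_eigenspace a"
    by (auto simp: gen_eigenspace_def funpow_shift_scale)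
qed

lemma shift_in_gen_eigenspaceD:
  assumes "shift a v \<in> gen_eigenspace a"
  shows "v \<in> gen_eigenspace a"
proof -
  obtain n where "(shift a ^^ n) (shift a v) = 0"
    using assms by (auto simp: gen_eigenspace_def)
  then have "(shift a ^^ Suc n) v = 0"
    by (simp add: funpow_swap1)
  then show ?thesis
    unfolding gen_eigenspace_def by blast
qed

text \<open>On the generalized eigenspace of \<open>b\<close> the operator \<open>T - a\<close> is a nonzero scalar plus a nilpotent
  operator, so it is invertible there; the induction on the nilpotency order replaces the
  geometric series for the inverse.\<close>

lemma shift_surj_gen_eigenspace:
  assumes "a \<noteq> b" "w \<in> gen_eigenspace b"
  shows "\<exists>u\<in>gen_eigenspace b. shift a u = w"
proof -
  obtain n where "(shift b ^^ n) w = 0"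
    using assms by (auto simp: gen_eigenspace_def)
  then show ?thesis
  proof (induction n arbitrary: w)
    case 0
    then show ?case
      using subspace_0[OF subspace_gen_eigenspace] shift_scale[of a 0 0] by auto
  next
    case (Suc n)
    have "(shift b ^^ n) (shift b w) = 0"
      using Suc.prems by (simp add: funpow_swap1)
    then obtain u where u: "u \<in> gen_eigenspace b" "shift a u = shift b w"
      using Suc.IH by blast
    have w: "w \<in> gen_eigenspace b"
      unfolding gen_eigenspace_def using Suc.prems by blast
    have "shift a (u - w) = (a - b) *\<^sub>C w"
      by (simp add: shift_diff u) (simp add: shift_def scale_left_diff_distrib)
    then have "shift a (inverse (a - b) *\<^sub>C (u - w)) = w"
      using assms(1) by (simp add: shift_scale)
    moreover have "inverse (a - b) *\<^sub>C (u - w) \<in> gen_eigenspace b"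
      using u w subspace_gen_eigenspace by (simp add: subspace_diff subspace_scale)
    ultimately show ?case by blast
  qed
qed

text \<open>Since \<open>T - a\<close> is invertible on all summands except that of \<open>a\<close> itself, modulo the
  generalized eigenspace of \<open>a\<close> every element of the sum \<open>S\<close> of all generalized eigenspaces is \<open>shift a u\<close> with \<open>u \<in> S\<close>. Hence \<open>S\<close> absorbs preimages under each \<open>T - a\<close>.\<close>

lemma shift_in_span_gen_eigenspacesD:
  assumes "shift a v \<in> span (\<Union>b. gen_eigenspace b)"
  shows "v \<in> span (\<Union>b. gen_eigenspace b)"
proof -
  let ?S = "span (\<Union>b. gen_eigenspace b)"
  let ?P = "{w. \<exists>u\<in>?S. w - shift a u \<in> gen_eigenspace a}"
  have in_S: "w \<in> ?S" if "w \<in> gen_eigenspace b" for w b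
    using that by (blast intro: span_base)
  have "subspace ?P"
  proof (rule subspaceI)
    show "0 \<in> ?P"
      using span_zero subspace_0[OF subspace_gen_eigenspace] shift_scale[of a 0 0] by force
  next
    fix x y assume "x \<in> ?P" "y \<in> ?P"
    then obtain u u' where u: "u \<in> ?S" "x - shift a u \<in> gen_eigenspace a"
      "u' \<in> ?S" "y - shift a u' \<in> gen_eigenspace a" by blast
    have "(x - shift a u) + (y - shift a u') \<in> gen_eigenspace a"
      using u subspace_gen_eigenspace by (blast intro: subspace_add)
    then have "(x + y) - shift a (u + u') \<in> gen_eigenspace a"
      by (simp add: shift_add algebra_simps)
    then show "x + y \<in> ?P" using u span_add by blast
  next
    fix r x assume "x \<in> ?P"
    then obtain u where u: "u \<in> ?S" "x - shift a u \<in> gen_eigenspace a" by blast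
    have "r *\<^sub>C x - shift a (r *\<^sub>C u) \<in> gen_eigenspace a"
      using subspace_scale[OF subspace_gen_eigenspace u(2), of r]
      by (simp add: shift_scale scale_right_diff_distrib)
    then show "r *\<^sub>C x \<in> ?P" using u span_scale by blast
  qed
  moreover have "(\<Union>b. gen_eigenspace b) \<subseteq> ?P"
  proof
    fix w assume "w \<in> (\<Union>b. gen_eigenspace b)"
    then obtain b where b: "w \<in> gen_eigenspace b" by blast
    show "w \<in> ?P"
    proof (cases "a = b")
      case True
      then have "w - shift a 0 \<in> gen_eigenspace a"
        using b shift_scale[of a 0 0] by simp
      then show ?thesis using span_zero by blast
    next
      case False
      then obtain u where "u \<in> gen_eigenspace b" "shift a u = w"
        using shift_surj_gen_eigenspace b by blast
      then show ?thesis
        using in_S subspace_0[OF subspace_gen_eigenspace] by force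
    qed
  qed
  ultimately have "?S \<subseteq> ?P"
    by (rule span_minimal[rotated])
  then obtain u where u: "u \<in> ?S" "shift a v - shift a u \<in> gen_eigenspace a"
    using assms by blast
  then have "v - u \<in> ?S"
    using in_S shift_in_gen_eigenspaceD[of a "v - u"] by (simp add: shift_diff)
  then show ?thesis
    using span_add[OF _ u(1), of "v - u"] by simp
qed

lemma poly_apply_eq_sum:
  assumes "degree p \<le> N"
  shows "poly_apply p v = (\<Sum>i\<le>N. coeff p i *\<^sub>C (T ^^ i) v)"
  unfolding poly_apply_def
  by (rule sum.mono_neutral_left) (use assms in \<open>auto simp: coeff_eq_0 not_le\<close>)

lemma poly_apply_add: "poly_apply (p + q) v = poly_apply p v + poly_apply q v"
proof -
  let ?N = "max (degree p) (degree q)"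
  have "degree (p + q) \<le> ?N" by (rule degree_add_le_max)
  then show ?thesis
    by (simp add: poly_apply_eq_sum[of _ ?N] scale_left_distrib sum.distrib)
qed

lemma poly_apply_smult: "poly_apply (smult a p) v = a *\<^sub>C poly_apply p v"
  by (simp add: poly_apply_eq_sum[of _ "degree p"] degree_smult_le scale_sum_right)

lemma poly_apply_pCons: "poly_apply (pCons a p) v = a *\<^sub>C v + poly_apply p (T v)"
proof -
  have "poly_apply (pCons a p) v =
      (\<Sum>i\<le>Suc (degree p). coeff (pCons a p) i *\<^sub>C (T ^^ i) v)"
    by (rule poly_apply_eq_sum) (rule degree_pCons_le)
  also have "\<dots> = a *\<^sub>C v + (\<Sum>i\<le>degree p. coeff p i *\<^sub>C (T ^^ Suc i) v)"
    by (subst sum.atMost_Suc_shift) simp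
  finally show ?thesis by (simp add: poly_apply_def funpow_swap1)
qed

lemma funpow_T_add: "(T ^^ n) (x + y) = (T ^^ n) x + (T ^^ n) y"
  by (induction n) (auto simp: T_add)

lemma funpow_T_scale: "(T ^^ n) (b *\<^sub>C x) = b *\<^sub>C (T ^^ n) x"
  by (induction n) (auto simp: T_scale)

lemma poly_apply_linear_factor:
  "poly_apply ([:- a, 1:] * p) v = poly_apply p (shift a v)"
proof -
  have "poly_apply ([:- a, 1:] * p) v = poly_apply p (T v) - a *\<^sub>C poly_apply p v"
    by (simp add: poly_apply_add poly_apply_smult poly_apply_pCons mult_pCons_left del: smult_minus_left)
  also have "\<dots> = poly_apply p (T v + (- a) *\<^sub>C v)"
    by (simp only: poly_apply_def funpow_T_add funpow_T_scale scale_right_distrib sum.distrib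
        scale_sum_right scale_left_commute[of "- a"]) (simp add: scale_sum_right sum_negf mult.commute)
  finally show ?thesis by (simp add: shift_def)
qed

lemma poly_annihilated_in_span_gen_eigenspaces:
  assumes "p \<noteq> 0" "poly_apply p v = 0"
  shows "v \<in> span (\<Union>b. gen_eigenspace b)"
  using assms
proof (induction "degree p" arbitrary: p v)
  case 0
  then obtain k where "p = [:k:]" by (metis degree_eq_zeroE)
  with 0 have "v = 0" by (auto simp: poly_apply_def)
  then show ?case using span_zero by simp
next
  case (Suc n)
  \<comment> \<open>Splitting off a root of \<open>p\<close> shows that \<open>shift a v\<close> is killed by a polynomial of smaller degree.\<close>
  have "\<not> constant (poly p)"
    using Suc.hyps(2) by (simp add: constant_degree)
  then obtain a where "poly p a = 0"
    using fundamental_theorem_of_algebra by blast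
  then obtain q where q: "p = [:- a, 1:] * q"
    by (metis poly_eq_0_iff_dvd dvdE)
  with Suc.prems have "q \<noteq> 0" by auto
  then have "degree p = Suc (degree q)"
    unfolding q by (subst degree_mult_eq) auto
  moreover have "poly_apply q (shift a v) = 0"
    using Suc.prems(2) by (simp only: q poly_apply_linear_factor)
  ultimately show ?case
    using Suc.hyps(1)[of q "shift a v"] Suc.hyps(2) \<open>q \<noteq> 0\<close>
    by (simp add: shift_in_span_gen_eigenspacesD)
qed

lemma poly_apply_0: "poly_apply 0 v = 0"
  by (simp add: poly_apply_def)

lemma poly_apply_monom: "poly_apply (monom b i) v = b *\<^sub>C (T ^^ i) v"
proof -
  have "poly_apply (monom b i) v = (\<Sum>j\<le>i. (if i = j then b *\<^sub>C (T ^^ j) v else 0))"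
    by (subst poly_apply_eq_sum[OF degree_monom_le], rule sum.cong) auto
  then show ?thesis by simp
qed

lemma poly_apply_sum_monom:
  assumes "finite J"
  shows "poly_apply (\<Sum>i\<in>J. monom (k i) i) v = (\<Sum>i\<in>J. k i *\<^sub>C (T ^^ i) v)"
  using assms
  by (induction J rule: finite_induct) (simp_all add: poly_apply_add poly_apply_monom poly_apply_0)

lemma annihilating_poly_of_relation:
  assumes "finite J" "(\<Sum>i\<in>J. k i *\<^sub>C (T ^^ i) v) = 0" "j \<in> J" "k j \<noteq> 0"
  shows "\<exists>p. p \<noteq> 0 \<and> poly_apply p v = 0"
proof (intro exI conjI)
  have "coeff (\<Sum>i\<in>J. monom (k i) i) j = k j"
    using assms(1,3) by (simp add: coeff_sum)
  then show "(\<Sum>i\<in>J. monom (k i) i) \<noteq> 0"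
    using assms(4) by (metis coeff_0)
  show "poly_apply (\<Sum>i\<in>J. monom (k i) i) v = 0"
    using assms(2) by (simp only: poly_apply_sum_monom[OF assms(1)])
qed

text \<open>The iterates of \<open>v\<close> under \<open>T\<close> either repeat or form an infinite, hence dependent, set; both
  give a nontrivial linear relation between them.\<close>

lemma exists_annihilating_poly:
  assumes "finite B" "span B = UNIV"
  shows "\<exists>p. p \<noteq> 0 \<and> poly_apply p v = 0"
proof -
  let ?f = "\<lambda>i. (T ^^ i) v"
  show ?thesis
  proof (cases "inj ?f")
    case True
    then have "infinite (range ?f)"
      by (simp add: finite_image_iff)
    then have "dependent (range ?f)"
      using independent_span_bound[OF assms(1)] assms(2) by blast
    then obtain t u y where t: "finite t" "t \<subseteq> range ?f" "(\<Sum>w\<in>t. u w *\<^sub>C w) = 0" "y \<in> t" "u y \<noteq> 0"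
      unfolding dependent_explicit by blast
    define I where "I = ?f -` t"
    have t_eq: "t = ?f ` I" using t(2) by (auto simp: I_def)
    have inj: "inj_on ?f I" using True by (rule inj_on_subset) simp
    have "finite I" using t(1) inj unfolding t_eq by (simp add: finite_image_iff)
    moreover have "(\<Sum>i\<in>I. u (?f i) *\<^sub>C ?f i) = 0"
      using t(3) unfolding t_eq by (simp add: sum.reindex[OF inj])
    moreover obtain j where "j \<in> I" "u (?f j) \<noteq> 0"
      using t(4,5) unfolding t_eq by blast
    ultimately show ?thesis using annihilating_poly_of_relation[of I "\<lambda>i. u (?f i)"] by blast
  next
    case False
    then obtain i j where ij: "i \<noteq> j" "?f i = ?f j" by (auto simp: inj_def)
    have "(\<Sum>m\<in>{i, j}. (if m = i then 1 else - 1) *\<^sub>C ?f m) = ?f i - ?f j"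
      using ij(1) by simp
    then have "(\<Sum>m\<in>{i, j}. (if m = i then 1 else - 1) *\<^sub>C ?f m) = 0"
      using ij(2) by simp
    then show ?thesis 
      using annihilating_poly_of_relation[of "{i, j}" "\<lambda>m. if m = i then 1 else - 1" v i] by simp
  qed
qed

lemma span_gen_eigenspaces:
  assumes "finite B" "span B = UNIV"
  shows "span (\<Union>b. gen_eigenspace b) = UNIV"
  using exists_annihilating_poly[OF assms] poly_annihilated_in_span_gen_eigenspaces by blast

end

section \<open>Left multiplications and the Cartan subalgebra\<close>

context left_symmetric_algebra
begin

lemma mult_zero_left: "0 \<bullet> x = 0"
  using mult_scale_left[of 0 0 x] by simp

lemma mult_zero_right: "x \<bullet> 0 = 0"
  using mult_scale_right[of x 0 0] by simp

text \<open>For \<open>x\<close> in the kernel all terms of the left-symmetric identity but \<open>(y \<bullet> x) \<bullet> z\<close> contain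
  \<open>x\<close> as a left factor acting on something.\<close>

lemma two_sided_ideal_left_kernel: "two_sided_ideal {x. \<forall>y. x \<bullet> y = 0}"
proof -
  have "(y \<bullet> x) \<bullet> z = 0" if "\<forall>y. x \<bullet> y = 0" for x y z
    using left_symmetric[of x y z] that by (simp add: mult_zero_left mult_zero_right)
  moreover have "subspace {x. \<forall>y. x \<bullet> y = 0}"
    by (rule subspaceI) (auto simp: mult_zero_left mult_add_left mult_scale_left)
  ultimately show ?thesis
    by (auto simp: two_sided_ideal_def mult_zero_left)
qed

lemma simple_left_faithful:
  assumes "simple" "x \<noteq> 0"
  shows "\<exists>y. x \<bullet> y \<noteq> 0"
proof -
  let ?K = "{x. \<forall>y. x \<bullet> y = 0}"
  have "?K \<noteq> UNIV" using assms(1) by (auto simp: simple_def)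
  then have "?K = {0}"
    using assms(1) two_sided_ideal_left_kernel by (auto simp: simple_def)
  then show ?thesis using assms(2) by blast
qed

lemma dim_le_1_in_span:
  assumes "dim A \<le> 1" "v \<in> A" "v \<noteq> 0" "w \<in> A"
  shows "w \<in> span {v}"
proof (rule ccontr)
  assume w: "w \<notin> span {v}"
  then have ind: "independent {w, v}"
    using assms(3) by (simp add: independent_insert)
  obtain B where B: "B \<subseteq> A" "independent B" "A \<subseteq> span B" "card B = dim A"
    using basis_exists[of A] by blast
  obtain F where "finite F" "span F = UNIV" using finite_dim by blast
  then have "finite B" using independent_span_bound B(2) by blast
  then have "card {w, v} \<le> card B"
    using independent_span_bound[OF _ ind] B(3) assms(2,4) by blast
  moreover have "w \<noteq> v" using w span_base by blast
  ultimately show False using assms(1) B(4) by simp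
qed

lemma funpow_bracket_in_lower_central:
  assumes "x \<in> h" "y \<in> h"
  shows "(bracket x ^^ n) y \<in> lower_central h n"
proof (induction n)
  case 0
  then show ?case using assms by simp
next
  case (Suc n)
  then have "bracket x ((bracket x ^^ n) y) \<in> {bracket x y |x y. x \<in> h \<and> y \<in> lower_central h n}"
    using assms(1) by blast
  then show ?case by (simp add: span_base)
qed

lemma cartan_subset_zero_root_space:
  assumes "cartan_subalgebra h"
  shows "h \<subseteq> root_space bracket h (\<lambda>_. 0)"
proof -
  obtain n where "lower_central h n = {0}"
    using assms by (auto simp: cartan_subalgebra_def)
  then have "(bracket x ^^ n) y = 0" if "x \<in> h" "y \<in> h" for x y
    using funpow_bracket_in_lower_central[OF that, of n] by simp
  then show ?thesis
    by (auto simp: root_space_def)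
qed

text \<open>The root space of zero for \<open>L\<close> has dimension at most one and contains \<open>h\<close> only because it
  agrees with the one for the adjoint action, where nilpotency of \<open>h\<close> applies. That \<open>h\<close> is not
  zero follows from self-normalization: the normalizer of zero is the whole algebra.\<close>

lemma canonical_cartan_line:
  assumes "canonical_cartan h"
    and dim: "dim (root_space mult h (\<lambda>_. 0)) \<le> 1"
    and e0: "e0 \<in> root_space mult h (\<lambda>_. 0)" "e0 \<noteq> 0"
  shows "h = span {e0}"
proof -
  have cartan: "cartan_subalgebra h"
    and eq: "root_space mult h (\<lambda>_. 0) = root_space bracket h (\<lambda>_. 0)"
    using assms(1) by (auto simp: canonical_cartan_def functional_on_def)
  have sub: "subspace h" and norm: "{x. \<forall>y\<in>h. bracket x y \<in> h} = h"
    using cartan by (auto simp: cartan_subalgebra_def lie_subalgebra_def)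
  have le: "h \<subseteq> span {e0}"
    using cartan_subset_zero_root_space[OF cartan] dim_le_1_in_span[OF dim e0] eq by blast
  have "h \<noteq> {0}"
  proof
    assume "h = {0}"
    moreover from this have "e0 \<in> {x. \<forall>y\<in>h. bracket x y \<in> h}"
      by (simp add: bracket_def mult_zero_left mult_zero_right)
    ultimately show False using norm e0(2) by blast
  qed
  then obtain x where x: "x \<in> h" "x \<noteq> 0" using subspace_0[OF sub] by blast
  then obtain k where k: "x = k *\<^sub>C e0" using le span_singleton by blast
  then have "e0 = inverse k *\<^sub>C x" using x(2) by auto
  then have "e0 \<in> h" using subspace_scale[OF sub x(1)] by simp
  then show ?thesis using le span_minimal[OF _ sub] by blast
qed

lemma endomorphism_left_mult: "endomorphism scale (mult x)"
  by unfold_locales (simp_all add: mult_add_right mult_scale_right)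

lemma functional_on_line:
  assumes "e0 \<noteq> 0"
  obtains l where "functional_on (span {e0}) l" "\<And>k. l (k *\<^sub>C e0) = k * \<mu>"
proof
  define l where "l x = (SOME k. x = k *\<^sub>C e0) * \<mu>" for x
  show l: "l (k *\<^sub>C e0) = k * \<mu>" for k
    using assms by (simp add: l_def)
  show "functional_on (span {e0}) l"
    unfolding functional_on_def span_singleton
    by (auto simp: l algebra_simps simp flip: scale_left_distrib)
qed

text \<open>For \<open>x = k *\<^sub>C e0\<close> the operator \<open>L x - l x\<close> is \<open>k\<close> times \<open>L e0 - \<mu>\<close>, so a generalized
  eigenvector of the single operator \<open>L e0\<close> is one for all operators \<open>L x\<close> with \<open>x\<close> on the line.\<close>

lemma gen_eigenspace_subset_root_space:
  assumes "\<And>k. l (k *\<^sub>C e0) = k * \<mu>"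
  shows "endomorphism.gen_eigenspace scale (mult e0) \<mu> \<subseteq> root_space mult (span {e0}) l"
proof
  interpret E: endomorphism scale "mult e0" by (rule endomorphism_left_mult)
  fix v assume "v \<in> E.gen_eigenspace \<mu>"
  then obtain n where n: "(E.shift \<mu> ^^ n) v = 0" by (auto simp: E.gen_eigenspace_def)
  have "((\<lambda>w. x \<bullet> w - l x *\<^sub>C w) ^^ n) v = 0" if x: "x \<in> span {e0}" for x
  proof -
    obtain k where k: "x = k *\<^sub>C e0" using x by (auto simp: span_singleton)
    have step: "(\<lambda>w. x \<bullet> w - l x *\<^sub>C w) = (\<lambda>w. k *\<^sub>C E.shift \<mu> w)"
      by (simp add: k assms mult_scale_left E.shift_def scale_right_diff_distrib)
    have "((\<lambda>w. k *\<^sub>C E.shift \<mu> w) ^^ m) v = k ^ m *\<^sub>C (E.shift \<mu> ^^ m) v" for m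
      by (induction m) (auto simp: E.shift_scale)
    then show ?thesis by (simp add: step n)
  qed
  then show "v \<in> root_space mult (span {e0}) l"
    by (auto simp: root_space_def)
qed

lemma span_root_base:
  assumes "canonical_cartan h"
    and dim: "\<forall>l. functional_on h l \<longrightarrow> dim (root_space mult h l) \<le> 1"
    and e0: "e0 \<in> root_space mult h (\<lambda>_. 0)" "e0 \<noteq> 0"
    and base: "root_base h e0 e"
  shows "span (e ` root_numbers h e0) = UNIV"
proof -
  interpret E: endomorphism scale "mult e0" by (rule endomorphism_left_mult)
  have "functional_on h (\<lambda>_. 0)" by (simp add: functional_on_def)
  then have h: "h = span {e0}"
    using canonical_cartan_line assms(1) dim e0 by blast
  have "w \<in> span (e ` root_numbers h e0)" if w: "w \<in> E.gen_eigenspace \<mu>" for w \<mu>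
  proof (cases "w = 0")
    case True
    then show ?thesis using span_zero by simp
  next
    case False
    obtain l where l: "functional_on h l" "\<And>k. l (k *\<^sub>C e0) = k * \<mu>"
      using functional_on_line[OF e0(2)] h by blast
    have "l e0 = \<mu>" using l(2)[of 1] by simp
    have w': "w \<in> root_space mult h l"
      using gen_eigenspace_subset_root_space[OF l(2)] w h by blast
    then have nz: "root_space mult h l \<noteq> {0}" using False by blast
    then have "e \<mu> \<in> root_space mult h l" "e \<mu> \<noteq> 0"
      using base l(1) \<open>l e0 = \<mu>\<close> by (auto simp: root_base_def)
    then have "w \<in> span {e \<mu>}"
      using dim_le_1_in_span dim l(1) w' by blast
    moreover have "\<mu> \<in> root_numbers h e0"
      using l(1) nz \<open>l e0 = \<mu>\<close> by (auto simp: root_numbers_def)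
    ultimately show ?thesis using span_mono[of "{e \<mu>}"] by blast
  qed
  then have "span (\<Union>\<mu>. E.gen_eigenspace \<mu>) \<subseteq> span (e ` root_numbers h e0)"
    by (intro span_minimal subspace_span) blast
  then show ?thesis
    using finite_dim E.span_gen_eigenspaces by blast
qed

lemma root_vector_mult_nonzero:
  assumes "simple" "root_base h e0 e" "span (e ` root_numbers h e0) = UNIV"
    and \<alpha>: "\<alpha> \<in> root_numbers h e0"
  shows "\<exists>\<beta>\<in>root_numbers h e0. e \<alpha> \<bullet> e \<beta> \<noteq> 0"
proof (rule ccontr)
  assume "\<not> ?thesis"
  then have "e ` root_numbers h e0 \<subseteq> {y. e \<alpha> \<bullet> y = 0}" by blast
  moreover have "subspace {y. e \<alpha> \<bullet> y = 0}"
    by (rule subspaceI) (auto simp: mult_zero_right mult_add_right mult_scale_right)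
  ultimately have "span (e ` root_numbers h e0) \<subseteq> {y. e \<alpha> \<bullet> y = 0}"
    by (rule span_minimal)
  moreover have "e \<alpha> \<noteq> 0"
    using assms(2) \<alpha> by (auto simp: root_base_def root_numbers_def)
  ultimately show False
    using simple_left_faithful assms(1,3) by blast
qed

end

section \<open>Edges of the graphs\<close>

theorem mainTheorem9:
  fixes scale :: "complex \<Rightarrow> 'a::ab_group_add \<Rightarrow> 'a"
    and mult :: "'a \<Rightarrow> 'a \<Rightarrow> 'a"
    and h :: "'a set" and e0 :: 'a
    and \<Lambda> :: "complex set" and e :: "complex \<Rightarrow> 'a"
    and c :: "complex \<Rightarrow> complex \<Rightarrow> complex"
  assumes "left_symmetric_algebra scale mult"
    and "left_symmetric_algebra.complete scale mult"
    and "left_symmetric_algebra.simple scale mult"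
    and "left_symmetric_algebra.canonical_cartan scale mult h"
    and "\<forall>l. left_symmetric_algebra.functional_on scale h l \<longrightarrow>
           vector_space.dim scale (left_symmetric_algebra.root_space scale mult h l) \<le> 1"
    and "e0 \<in> left_symmetric_algebra.root_space scale mult h (\<lambda>_. 0)" and "e0 \<noteq> 0"
    and "\<Lambda> = left_symmetric_algebra.root_numbers scale mult h e0"
    and "left_symmetric_algebra.root_base scale mult h e0 e"
    and "left_symmetric_algebra.structure_constants scale mult \<Lambda> e c"
  shows "\<forall>\<alpha>\<in>\<Lambda>. (\<exists>\<beta>\<in>\<Lambda>. \<beta> + \<alpha> \<in> \<Lambda> \<and> (\<beta>, \<beta> + \<alpha>) \<in> Gamma_l \<Lambda> c) \<and>
               (\<exists>\<beta>. (\<alpha>, \<beta>) \<in> Gamma_r \<Lambda> c)"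
proof
  interpret left_symmetric_algebra scale mult by (rule assms(1))
  fix \<alpha> assume \<alpha>: "\<alpha> \<in> \<Lambda>"
  have "span (e ` root_numbers h e0) = UNIV"
    by (rule span_root_base) (fact assms)+
  then obtain \<beta> where \<beta>: "\<beta> \<in> \<Lambda>" "mult (e \<alpha>) (e \<beta>) \<noteq> 0"
    using root_vector_mult_nonzero assms(3,8,9) \<alpha> by blast
  have "mult (e \<alpha>) (e \<beta>) = scale (c \<alpha> \<beta>) (e (\<alpha> + \<beta>))"
    using assms(10) \<alpha> \<beta>(1) by (auto simp: structure_constants_def)
  with \<beta>(2) have "c \<alpha> \<beta> \<noteq> 0" and "e (\<alpha> + \<beta>) \<noteq> 0" by auto
  moreover from this have "\<alpha> + \<beta> \<in> \<Lambda>"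
    using assms(8,9) by (auto simp: root_base_def)
  ultimately have "(\<beta>, \<beta> + \<alpha>) \<in> Gamma_l \<Lambda> c" "(\<alpha>, \<alpha> + \<beta>) \<in> Gamma_r \<Lambda> c" "\<beta> + \<alpha> \<in> \<Lambda>"
    using \<alpha> \<beta>(1) by (auto simp: Gamma_l_def Gamma_r_def add.commute)
  then show "(\<exists>\<beta>\<in>\<Lambda>. \<beta> + \<alpha> \<in> \<Lambda> \<and> (\<beta>, \<beta> + \<alpha>) \<in> Gamma_l \<Lambda> c) \<and> (\<exists>\<beta>. (\<alpha>, \<beta>) \<in> Gamma_r \<Lambda> c)"
    using \<beta>(1) by blast
qed

end
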